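(* Let $P_1,\ldots,P_r$ be polytopes (in a common Euclidean space) that are relatively in general position, and let $P=P_1+\cdots+P_r$ be their Minkowski sum, of dimension $d$. Let $S\subseteq\{1,\dots,r\}$ be the set of indices $i$ for which $\dim(P_i)<d$. Then $$\sum_{k=0}^{d-1}(-1)^k\, k\, f^\delta_k(P) = (-1)^{d+1}\sum_{i\in S}\dim(P_i).$$
   Context: Polytopes are nonempty convex polytopes. For a polytope $Q$, $f_k(Q)$ denotes the number of $k$-dimensional faces of $Q$ (including $Q$ itself, so $f_{\dim Q}(Q)=1$ and $f_k(Q)=0$ for $k>\dim Q$). Every nonempty face $F$ of a Minkowski sum $P=P_1+\cdots+P_r$ can be written uniquely as $F=F_1+\cdots+F_r$ with $F_i$ a nonempty face of $P_i$; this is called the decomposition of $F$. The decomposition is exact if $\dim(F)=\dim(F_1)+\cdots+\dim(F_r)$. The polytopes $P_1,\ldots,P_r$ are relatively in general position if every facet of $P_1+\cdots+P_r$ has an exact decomposition. For a nonempty face $F$ of $P$ with decomposition $F=F_1+\cdots+F_r$, set $f^\delta_k(F)=f_k(F)-(f_k(F_1)+\cdots+f_k(F_r))$. In particular $f^\delta_k(P)=f_k(P)-(f_k(P_1)+\cdots+f_k(P_r))$. *)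

theory Defs
  imports "HOL-Analysis.Analysis"
begin

definition num_faces :: "nat \<Rightarrow> 'a::euclidean_space set \<Rightarrow> nat" where
  "num_faces k Q = card {F. F face_of Q \<and> aff_dim F = int k}"

text \<open>A Minkowski sum of an indexed family is the library's elementwise sum of sets,
  so \<^term>\<open>sum G I\<close> is the Minkowski sum of the sets \<open>G i\<close> with \<open>i \<in> I\<close>.\<close>

definition decomposition ::
    "'i set \<Rightarrow> ('i \<Rightarrow> 'a::euclidean_space set) \<Rightarrow> 'a set \<Rightarrow> ('i \<Rightarrow> 'a set) \<Rightarrow> bool" where
  "decomposition I P F G \<longleftrightarrow>
     (\<forall>i\<in>I. G i face_of P i \<and> G i \<noteq> {}) \<and> F = sum G I"

definition exact :: "'i set \<Rightarrow> 'a::euclidean_space set \<Rightarrow> ('i \<Rightarrow> 'a set) \<Rightarrow> bool" where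
  "exact I F G \<longleftrightarrow> aff_dim F = (\<Sum>i\<in>I. aff_dim (G i))"

text \<open>Every nonempty face of a Minkowski sum of nonempty polytopes has a decomposition, and it is
  unique on \<open>I\<close>; hence \<open>\<exists>G\<close> below refers to the decomposition of the facet.\<close>

definition relatively_in_general_position ::
    "'i set \<Rightarrow> ('i \<Rightarrow> 'a::euclidean_space set) \<Rightarrow> bool" where
  "relatively_in_general_position I P \<longleftrightarrow>
     (\<forall>F. F facet_of sum P I \<longrightarrow> (\<exists>G. decomposition I P F G \<and> exact I F G))"

text \<open>The number \<open>f\<^sup>\<delta>\<^sub>k(F)\<close> of a face \<open>F\<close> depends on its decomposition \<open>G\<close>, from which \<open>F\<close> is
  recovered as \<^term>\<open>sum G I\<close>. The decomposition of the whole sum \<^term>\<open>sum P I\<close> is \<open>P\<close> itself.\<close>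

definition f_delta :: "nat \<Rightarrow> 'i set \<Rightarrow> ('i \<Rightarrow> 'a::euclidean_space set) \<Rightarrow> int" where
  "f_delta k I G = int (num_faces k (sum G I)) - (\<Sum>i\<in>I. int (num_faces k (G i)))"

end

theory Submission
  imports Defs
begin

text \<open>
  The idea is to trade sums over faces for integrals over the dual space. A linear functional \<open>u\<close>
  picks out the face \<open>Q\<^sup>u\<close> of a polytope \<open>Q\<close> on which it is maximal, and every nonempty face arises
  in this way. Taking such faces commutes with Minkowski addition: \<open>P\<^sup>u\<close> is the sum of the
  \<open>P\<^sub>i\<^sup>u\<close>, so that \<open>u \<mapsto> (P\<^sub>i\<^sup>u)\<^sub>i\<close> runs through the decompositions of all faces of \<open>P\<close>
  simultaneously.

  The functionals that pick out a given face \<open>F\<close> form a relatively open cone of codimension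
  \<open>dim F\<close>. Hence \<open>\<Sum>\<^sub>F (-1)\<^bsup>dim F\<^esup> g(F)\<close> is, up to a global sign, the integral of \<open>u \<mapsto> g(Q\<^sup>u)\<close>
  with respect to the Euler characteristic. To make such integrals available by elementary means,
  only functions that are constant on the cells of some finite central hyperplane arrangement are
  integrated; a cell contributes \<open>-1\<close> to the power of its codimension. The essential point is that
  the result does not depend on the arrangement (\<open>euler_integral_refine\<close>): a new hyperplane
  either leaves a cell alone or cuts it into two pieces of the same dimension and one of dimension
  one less, whose signs add up to the sign of the cell. Each of the cones above is a
  single cell of a coarse arrangement, and a common refinement serves all polytopes at once
  (\<open>alternating_face_sum_eq_euler_integral\<close>).

  Now integrate \<open>dim P\<^sup>u - \<Sum>\<^sub>i dim P\<^sub>i\<^sup>u\<close>. General position makes the integrand vanish whenever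
  \<open>P\<^sup>u\<close> is a proper face, because exactness passes from a facet to its faces
  (\<open>proper_maximal_face_exact\<close>). Otherwise \<open>P\<^sup>u = P\<close> and therefore \<open>P\<^sub>i\<^sup>u = P\<^sub>i\<close> for all \<open>i\<close>. So the
  integral is \<open>dim P - \<Sum>\<^sub>i dim P\<^sub>i\<close> times the integral of the indicator of \<open>P\<^sup>u = P\<close>, which is
  \<open>(-1)\<^bsup>dim P\<^esup>\<close>. On the other hand it equals
  \<open>\<Sum>\<^sub>F (-1)\<^bsup>dim F\<^esup> dim F\<close> over the faces of \<open>P\<close> minus the corresponding sums for the \<open>P\<^sub>i\<close>.
  The theorem follows by removing the faces of dimension \<open>d\<close> from these sums: \<open>P\<close> itself and those
  \<open>P\<^sub>i\<close> that are full-dimensional in \<open>P\<close>.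
\<close>

section \<open>Euler integrals over the cells of a central hyperplane arrangement\<close>

definition sign_cell :: "'a::euclidean_space set \<Rightarrow> 'a \<Rightarrow> 'a set" where
  "sign_cell A u = {v. \<forall>a\<in>A. sgn (a \<bullet> v) = sgn (a \<bullet> u)}"

definition vanishing_vectors :: "'a::euclidean_space set \<Rightarrow> 'a set \<Rightarrow> 'a set" where
  "vanishing_vectors A C = {a \<in> A. \<forall>v\<in>C. a \<bullet> v = 0}"

text \<open>
  Up to the factor \<open>(-1)\<^sup>n\<close>, with \<open>n\<close> the dimension of the space, this is integration with respect
  to the Euler characteristic with compact supports: a cell of dimension \<open>k\<close> is homeomorphic to \<open>\<real>\<^sup>k\<close>
  and has Euler characteristic \<open>(-1)\<^sup>k\<close>, and the vectors of \<open>A\<close> that vanish on it span a space of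
  dimension \<open>n - k\<close>. The chosen point of a cell is immaterial for the functions of interest, which
  are constant on cells.
\<close>
definition euler_integral :: "'a::euclidean_space set \<Rightarrow> ('a \<Rightarrow> int) \<Rightarrow> int" where
  "euler_integral A h =
     (\<Sum>C\<in>range (sign_cell A). (-1) ^ dim (vanishing_vectors A C) * h (SOME v. v \<in> C))"

definition constant_on_cells :: "'a::euclidean_space set \<Rightarrow> ('a \<Rightarrow> 'b) \<Rightarrow> bool" where
  "constant_on_cells A h \<longleftrightarrow> (\<forall>u. \<forall>v\<in>sign_cell A u. h v = h u)"

lemma sign_cell_self [simp]: "u \<in> sign_cell A u"
  by (simp add: sign_cell_def)

lemma sign_cell_eq_iff: "sign_cell A u = sign_cell A v \<longleftrightarrow> v \<in> sign_cell A u"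
  by (auto simp: sign_cell_def)

lemma sign_cell_antimono: "A \<subseteq> B \<Longrightarrow> sign_cell B u \<subseteq> sign_cell A u"
  by (auto simp: sign_cell_def)

lemma some_in_sign_cell: "(SOME v. v \<in> sign_cell A u) \<in> sign_cell A u"
  by (rule someI [of _ u]) simp

lemma constant_on_cells_some:
  "constant_on_cells A h \<Longrightarrow> h (SOME v. v \<in> sign_cell A u) = h u"
  by (simp add: constant_on_cells_def some_in_sign_cell)

lemma constant_on_cells_mono:
  "constant_on_cells A h \<Longrightarrow> A \<subseteq> B \<Longrightarrow> constant_on_cells B h"
  unfolding constant_on_cells_def using sign_cell_antimono by blast

lemma constant_on_cells_indicator: "constant_on_cells A (\<lambda>v. of_bool (v \<in> sign_cell A u))"
  by (simp add: constant_on_cells_def sign_cell_def)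

lemma vanishing_vectors_sign_cell:
  "vanishing_vectors A (sign_cell A u) = {a \<in> A. a \<bullet> u = 0}"
proof -
  have "a \<bullet> v = 0" if "a \<in> A" "a \<bullet> u = 0" "v \<in> sign_cell A u" for a v
    using that by (auto simp: sign_cell_def sgn_zero_iff)
  then show ?thesis
    unfolding vanishing_vectors_def using sign_cell_self by blast
qed

lemma sign_cell_insert:
  "sign_cell (insert b A) u = {v \<in> sign_cell A u. sgn (b \<bullet> v) = sgn (b \<bullet> u)}"
  by (auto simp: sign_cell_def)

lemma sgn_real_cases: "sgn (x::real) \<in> {-1, 0, 1}"
  by (auto simp: sgn_real_def)

lemma finite_sign_cells:
  assumes "finite A"
  shows "finite (range (sign_cell A))"
  using assms
proof (induction A)
  case empty
  then show ?case
    by (simp add: sign_cell_def)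
next
  case (insert b A)
  have "range (sign_cell (insert b A)) \<subseteq>
      (\<lambda>(C, s). {v \<in> C. sgn (b \<bullet> v) = s}) ` (range (sign_cell A) \<times> {-1, 0, 1})"
    using sgn_real_cases by (force simp: sign_cell_insert image_iff)
  then show ?case
    by (rule finite_subset) (use insert in auto)
qed

text \<open>
  A cell is open in the subspace orthogonal to the vectors that vanish on it.
\<close>
lemma sign_cell_move:
  assumes "finite A" and "\<And>a. \<lbrakk>a \<in> A; a \<bullet> u = 0\<rbrakk> \<Longrightarrow> a \<bullet> y = 0"
  obtains t where "t > 0" "u + t *\<^sub>R y \<in> sign_cell A u" "u - t *\<^sub>R y \<in> sign_cell A u"
proof -
  have "\<forall>\<^sub>F t in at (0::real). \<forall>a\<in>A. sgn (a \<bullet> (u + t *\<^sub>R y)) = sgn (a \<bullet> u)"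
  proof (intro eventually_ball_finite \<open>finite A\<close> ballI)
    fix a assume "a \<in> A"
    have lim: "((\<lambda>t. a \<bullet> (u + t *\<^sub>R y)) \<longlongrightarrow> a \<bullet> (u + 0 *\<^sub>R y)) (at (0::real))"
      by (intro tendsto_intros)
    consider "a \<bullet> u = 0" | "a \<bullet> u > 0" | "a \<bullet> u < 0"
      by linarith
    then show "\<forall>\<^sub>F t in at (0::real). sgn (a \<bullet> (u + t *\<^sub>R y)) = sgn (a \<bullet> u)"
    proof cases
      case 1
      then show ?thesis
        using assms(2) \<open>a \<in> A\<close> by (simp add: inner_add_right)
    next
      case 2
      with lim have "\<forall>\<^sub>F t in at (0::real). 0 < a \<bullet> (u + t *\<^sub>R y)"
        by (intro order_tendstoD(1)) auto
      then show ?thesis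
        using 2 by (auto elim!: eventually_mono)
    next
      case 3
      with lim have "\<forall>\<^sub>F t in at (0::real). a \<bullet> (u + t *\<^sub>R y) < 0"
        by (intro order_tendstoD(2)) auto
      then show ?thesis
        using 3 by (auto elim!: eventually_mono)
    qed
  qed
  then obtain d where "d > 0"
    and d: "\<And>t. \<lbrakk>t \<noteq> 0; \<bar>t\<bar> < d\<rbrakk> \<Longrightarrow> \<forall>a\<in>A. sgn (a \<bullet> (u + t *\<^sub>R y)) = sgn (a \<bullet> u)"
    by (auto simp: eventually_at dist_real_def)
  show thesis
  proof
    show "d / 2 > 0"
      using \<open>d > 0\<close> by simp
    show "u + (d / 2) *\<^sub>R y \<in> sign_cell A u"
      using d [of "d / 2"] \<open>d > 0\<close> by (simp add: sign_cell_def)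
    show "u - (d / 2) *\<^sub>R y \<in> sign_cell A u"
      using d [of "- (d / 2)"] \<open>d > 0\<close> by (simp add: sign_cell_def)
  qed
qed

lemma sgn_pos_combination:
  fixes x y \<alpha> \<beta> :: real
  assumes "sgn x = sgn y" "\<alpha> > 0" "\<beta> > 0"
  shows "sgn (\<alpha> * x + \<beta> * y) = sgn y"
proof (cases y "0::real" rule: linorder_cases)
  case less
  then have "x < 0" using assms(1) by (simp add: sgn_1_neg)
  with less assms show ?thesis by (simp add: add_neg_neg mult_pos_neg)
next
  case equal
  then show ?thesis using assms(1) by (simp add: sgn_zero_iff)
next
  case greater
  then have "x > 0" using assms(1) by (simp add: sgn_1_pos)
  with greater assms show ?thesis by (simp add: add_pos_pos)
qed

lemma sign_cell_cone_combination:
  assumes "v \<in> sign_cell A u" "w \<in> sign_cell A u" "\<alpha> > 0" "\<beta> > 0"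
  shows "\<alpha> *\<^sub>R v + \<beta> *\<^sub>R w \<in> sign_cell A u"
  using assms sgn_pos_combination unfolding sign_cell_def by (simp add: inner_add_right)

text \<open>
  How a further hyperplane, orthogonal to \<open>b\<close>, meets a cell. If \<open>b\<close> is in the span of the vectors
  vanishing on the cell, the hyperplane contains the cell. If not, and if the hyperplane meets the
  cell at all, it separates points of it, since the cell is open in a subspace in which \<open>b\<close> does
  not vanish. Conversely, a convex cell with points on both sides meets the hyperplane.
\<close>
lemma new_signs_in_cell:
  fixes A :: "'a::euclidean_space set" and b u :: 'a
  assumes "finite A"
  defines "S \<equiv> (\<lambda>v. sgn (b \<bullet> v)) ` sign_cell A u"
  shows "b \<in> span {a \<in> A. a \<bullet> u = 0} \<Longrightarrow> S = {0}"
    and "b \<notin> span {a \<in> A. a \<bullet> u = 0} \<Longrightarrow> S = {1} \<or> S = {-1} \<or> S = {-1, 0, 1}"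
proof -
  let ?Z = "{a \<in> A. a \<bullet> u = 0}"
  assume b: "b \<in> span ?Z"
  have "b \<bullet> v = 0" if "v \<in> sign_cell A u" for v
    using b
  proof (induction rule: span_induct)
    case base
    show ?case
      by (simp add: subspace_hyperplane2)
  next
    case (step a)
    then show ?case
      using that by (auto simp: sign_cell_def sgn_zero_iff)
  qed
  then have "sgn (b \<bullet> v) = 0" if "v \<in> sign_cell A u" for v
    using that by simp
  moreover have "sign_cell A u \<noteq> {}"
    using sign_cell_self by blast
  ultimately show "S = {0}"
    unfolding S_def by (auto simp: image_iff)
next
  let ?Z = "{a \<in> A. a \<bullet> u = 0}"
  assume b: "b \<notin> span ?Z"
  have zero_imp: "{-1, 1} \<subseteq> S" if "0 \<in> S"
  proof -
    from that obtain v where "v \<in> sign_cell A u" "sgn (b \<bullet> v) = 0"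
      unfolding S_def by (metis imageE)
    then have v: "v \<in> sign_cell A u" "b \<bullet> v = 0"
      by (simp_all add: sgn_zero_iff)
    \<comment> \<open>the component of \<open>b\<close> orthogonal to the vanishing vectors: a direction inside the cell along
      which \<open>b\<close> increases\<close>
    obtain p y where py: "p \<in> span ?Z" "\<And>w. w \<in> span ?Z \<Longrightarrow> orthogonal y w" "b = p + y"
      using orthogonal_subspace_decomp_exists [of ?Z b] by blast
    have "y \<noteq> 0"
      using b py by auto
    moreover have "b \<bullet> y = y \<bullet> y"
      using py by (simp add: inner_add_left inner_add_right orthogonal_def inner_commute)
    ultimately have b_y: "b \<bullet> y > 0"
      by simp
    have vanish: "a \<bullet> y = 0" if "a \<in> A" "a \<bullet> v = 0" for a
    proof -
      have "a \<in> ?Z"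
        using that v(1) unfolding sign_cell_def by (metis (mono_tags, lifting) mem_Collect_eq sgn_zero_iff)
      then show ?thesis
        using py(2) by (simp add: span_base orthogonal_def inner_commute)
    qed
    obtain t where t: "t > 0" "v + t *\<^sub>R y \<in> sign_cell A v" "v - t *\<^sub>R y \<in> sign_cell A v"
      using sign_cell_move [OF \<open>finite A\<close> vanish] by blast
    have same: "sign_cell A v = sign_cell A u"
      using v(1) sign_cell_eq_iff by blast
    have "sgn (b \<bullet> (v + t *\<^sub>R y)) = 1" "sgn (b \<bullet> (v - t *\<^sub>R y)) = -1"
      using b_y t(1) v(2) by (simp_all add: inner_add_right inner_diff_right)
    with t(2,3) have "1 \<in> S" "-1 \<in> S"
      unfolding S_def same by (metis image_eqI)+
    then show ?thesis
      by simp
  qed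
  have imp_zero: "0 \<in> S" if both: "1 \<in> S" "-1 \<in> S"
  proof -
    obtain v w where "v \<in> sign_cell A u" "sgn (b \<bullet> v) = 1" "w \<in> sign_cell A u" "sgn (b \<bullet> w) = -1"
      using both unfolding S_def by (elim imageE) metis
    then have v: "v \<in> sign_cell A u" "b \<bullet> v > 0" and w: "w \<in> sign_cell A u" "b \<bullet> w < 0"
      by (simp_all add: sgn_1_pos sgn_1_neg)
    \<comment> \<open>a positive combination of \<open>v\<close> and \<open>w\<close>, as \<open>b \<bullet> w\<close> is negative, chosen orthogonal to \<open>b\<close>\<close>
    let ?x = "(- (b \<bullet> w)) *\<^sub>R v + (b \<bullet> v) *\<^sub>R w"
    have "?x \<in> sign_cell A u"
      using v w by (intro sign_cell_cone_combination) auto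
    moreover have "sgn (b \<bullet> ?x) = 0"
      by (simp add: inner_diff_right mult.commute)
    ultimately show ?thesis
      unfolding S_def by (metis (no_types, lifting) image_eqI)
  qed
  have "S \<subseteq> {-1, 0, 1}"
    unfolding S_def using sgn_real_cases by blast
  moreover have "S \<noteq> {}"
    unfolding S_def using sign_cell_self by blast
  ultimately show "S = {1} \<or> S = {-1} \<or> S = {-1, 0, 1}"
    using zero_imp imp_zero by (cases "0 \<in> S") auto
qed

text \<open>
  Independence of the arrangement, one vector at a time. The cells of the larger arrangement are
  grouped by the cell \<open>C\<close> of the smaller one that contains them, and they are indexed within \<open>C\<close> by
  the sign of \<open>b\<close>. In the split case the signs \<open>1\<close> and \<open>-1\<close> each contribute the weight of \<open>C\<close>, and the
  sign \<open>0\<close> contributes its negative, because there the codimension has grown by one.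
\<close>
lemma euler_integral_insert:
  assumes "finite A" "constant_on_cells A h"
  shows "euler_integral (insert b A) h = euler_integral A h"
proof -
  let ?B = "insert b A"
  let ?w = "\<lambda>D. (-1::int) ^ dim (vanishing_vectors ?B D) * h (SOME v. v \<in> D)"
  let ?parent = "\<lambda>D. sign_cell A (SOME v. v \<in> D)"
  have parent: "?parent (sign_cell ?B v) = sign_cell A v" for v
    using some_in_sign_cell [of ?B v] sign_cell_antimono [of A ?B v]
    by (metis sign_cell_eq_iff subsetD subset_insertI)
  have fibre: "(\<Sum>D\<in>{D \<in> range (sign_cell ?B). ?parent D = C}. ?w D) =
      (-1) ^ dim (vanishing_vectors A C) * h (SOME v. v \<in> C)"
    if "C \<in> range (sign_cell A)" for C
  proof -
    from that obtain u where C: "C = sign_cell A u"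
      by blast
    let ?Z = "{a \<in> A. a \<bullet> u = 0}"
    let ?S = "(\<lambda>v. sgn (b \<bullet> v)) ` C"
    let ?T = "\<lambda>s. {x \<in> C. sgn (b \<bullet> x) = s}"
    have T: "?T (sgn (b \<bullet> v)) = sign_cell ?B v" if "v \<in> C" for v
      using that by (auto simp: C sign_cell_insert sign_cell_eq_iff sign_cell_def)
    have "{D \<in> range (sign_cell ?B). ?parent D = C} = ?T ` ?S"
    proof (intro equalityI subsetI)
      fix D assume "D \<in> {D \<in> range (sign_cell ?B). ?parent D = C}"
      then obtain v where v: "D = sign_cell ?B v" "sign_cell A v = C"
        using parent by auto
      then have "v \<in> C"
        using sign_cell_self by blast
      with v(1) T have "D = ?T (sgn (b \<bullet> v))" "sgn (b \<bullet> v) \<in> ?S"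
        by auto
      then show "D \<in> ?T ` ?S"
        by (rule image_eqI)
    next
      fix D assume "D \<in> ?T ` ?S"
      then obtain v where v: "v \<in> C" "D = sign_cell ?B v"
        using T by auto
      then have "sign_cell A v = C"
        by (metis C sign_cell_eq_iff)
      with v parent show "D \<in> {D \<in> range (sign_cell ?B). ?parent D = C}"
        by auto
    qed
    moreover have "inj_on ?T ?S"
      by (rule inj_onI) blast
    ultimately have "(\<Sum>D\<in>{D \<in> range (sign_cell ?B). ?parent D = C}. ?w D) = (\<Sum>s\<in>?S. ?w (?T s))"
      by (simp add: sum.reindex)
    also have "\<dots> = (\<Sum>s\<in>?S. (-1) ^ dim (if s = 0 then insert b ?Z else ?Z) * h u)"
    proof (rule sum.cong)
      fix s assume "s \<in> ?S"
      then obtain v where v: "v \<in> C" "s = sgn (b \<bullet> v)"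
        by blast
      have Z: "{a \<in> A. a \<bullet> v = 0} = ?Z"
        using v(1) by (auto simp: C sign_cell_def) (metis sgn_zero_iff)+
      have "vanishing_vectors ?B (?T s) = (if s = 0 then insert b ?Z else ?Z)"
        unfolding v(2) T [OF v(1)] vanishing_vectors_sign_cell Z [symmetric]
        by (auto simp: sgn_zero_iff)
      moreover have "(SOME x. x \<in> ?T s) \<in> sign_cell A u"
        unfolding v(2) T [OF v(1)] using parent [of v] v(1) by (metis C sign_cell_eq_iff sign_cell_self)
      then have "h (SOME x. x \<in> ?T s) = h u"
        using assms(2) by (simp add: constant_on_cells_def)
      ultimately show "?w (?T s) = (-1) ^ dim (if s = 0 then insert b ?Z else ?Z) * h u"
        by simp
    qed simp
    also have "\<dots> = (-1) ^ dim ?Z * h u"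
    proof (cases "b \<in> span ?Z")
      case True
      then have "?S = {0}"
        using new_signs_in_cell(1) [OF \<open>finite A\<close>] by (simp add: C)
      then show ?thesis
        using True by (simp add: dim_insert)
    next
      case False
      then have "?S = {1} \<or> ?S = {-1} \<or> ?S = {-1, 0, 1}"
        using new_signs_in_cell(2) [OF \<open>finite A\<close>] by (simp add: C)
      then show ?thesis
        using False by (elim disjE) (simp_all add: dim_insert)
    qed
    also have "\<dots> = (-1) ^ dim (vanishing_vectors A C) * h (SOME v. v \<in> C)"
      using assms(2) by (simp add: C vanishing_vectors_sign_cell constant_on_cells_some)
    finally show ?thesis .
  qed
  have "euler_integral ?B h =
      (\<Sum>C\<in>range (sign_cell A). \<Sum>D\<in>{D \<in> range (sign_cell ?B). ?parent D = C}. ?w D)"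
    unfolding euler_integral_def
    by (rule sum.group [symmetric]) (use \<open>finite A\<close> in \<open>auto intro: finite_sign_cells\<close>)
  also have "\<dots> = euler_integral A h"
    unfolding euler_integral_def by (rule sum.cong) (use fibre in auto)
  finally show ?thesis .
qed

lemma euler_integral_refine:
  assumes "finite B" "A \<subseteq> B" "constant_on_cells A h"
  shows "euler_integral B h = euler_integral A h"
proof -
  have "euler_integral (A \<union> D) h = euler_integral A h" if "finite D" for D
    using that
  proof (induction D)
    case (insert b D)
    have "constant_on_cells (A \<union> D) h"
      using assms(3) constant_on_cells_mono by blast
    then have "euler_integral (insert b (A \<union> D)) h = euler_integral (A \<union> D) h"
      using insert.hyps(1) assms finite_subset by (intro euler_integral_insert) auto
    with insert.IH show ?case
      by simp
  qed simp
  from this [OF \<open>finite B\<close>] \<open>A \<subseteq> B\<close> show ?thesis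
    by (simp add: Un_absorb1)
qed

lemma euler_integral_diff:
  "euler_integral A (\<lambda>u. h u - k u) = euler_integral A h - euler_integral A k"
  by (simp add: euler_integral_def right_diff_distrib sum_subtractf)

lemma euler_integral_sum:
  "euler_integral A (\<lambda>u. \<Sum>i\<in>I. h i u) = (\<Sum>i\<in>I. euler_integral A (h i))"
  unfolding euler_integral_def by (simp add: sum_distrib_left sum.swap [of _ I])

lemma euler_integral_cmult:
  "euler_integral A (\<lambda>u. c * h u) = c * euler_integral A h"
  unfolding euler_integral_def by (simp add: sum_distrib_left mult.left_commute)

lemma euler_integral_cell_indicator:
  assumes "finite A"
  shows "euler_integral A (\<lambda>v. of_bool (v \<in> sign_cell A u)) = (-1) ^ dim {a \<in> A. a \<bullet> u = 0}"
proof -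
  have "(SOME v. v \<in> C) \<in> sign_cell A u \<longleftrightarrow> C = sign_cell A u" if "C \<in> range (sign_cell A)" for C
    using that some_in_sign_cell sign_cell_eq_iff by (metis imageE)
  then have "euler_integral A (\<lambda>v. of_bool (v \<in> sign_cell A u)) =
      (\<Sum>C\<in>range (sign_cell A). if C = sign_cell A u then (-1) ^ dim (vanishing_vectors A C) else 0)"
    unfolding euler_integral_def by (intro sum.cong) auto
  also have "\<dots> = (-1) ^ dim {a \<in> A. a \<bullet> u = 0}"
    using assms by (simp add: sum.delta finite_sign_cells vanishing_vectors_sign_cell)
  finally show ?thesis .
qed

section \<open>Faces of maximisers and their normal cones\<close>

definition maximal_face :: "'a::euclidean_space set \<Rightarrow> 'a \<Rightarrow> 'a set" where
  "maximal_face Q u = {x \<in> Q. \<forall>y\<in>Q. u \<bullet> y \<le> u \<bullet> x}"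

lemma maximal_face_subset: "maximal_face Q u \<subseteq> Q"
  by (auto simp: maximal_face_def)

lemma maximal_face_zero [simp]: "maximal_face Q 0 = Q"
  by (auto simp: maximal_face_def)

lemma maximal_face_nonempty:
  assumes "compact Q" "Q \<noteq> {}"
  shows "maximal_face Q u \<noteq> {}"
proof -
  have "\<exists>x\<in>Q. \<forall>y\<in>Q. u \<bullet> y \<le> u \<bullet> x"
    using assms by (intro continuous_attains_sup continuous_intros) auto
  then show ?thesis
    by (auto simp: maximal_face_def)
qed

lemma maximal_face_eq_supporting:
  assumes "x \<in> maximal_face Q u"
  shows "maximal_face Q u = Q \<inter> {y. u \<bullet> y = u \<bullet> x}"
proof (rule set_eqI)
  fix y
  have x: "x \<in> Q" "\<And>z. z \<in> Q \<Longrightarrow> u \<bullet> z \<le> u \<bullet> x"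
    using assms by (auto simp: maximal_face_def)
  show "y \<in> maximal_face Q u \<longleftrightarrow> y \<in> Q \<inter> {y. u \<bullet> y = u \<bullet> x}"
  proof
    assume "y \<in> maximal_face Q u"
    then have "y \<in> Q" "u \<bullet> x \<le> u \<bullet> y"
      using x(1) by (simp_all add: maximal_face_def)
    with x(2) [of y] show "y \<in> Q \<inter> {y. u \<bullet> y = u \<bullet> x}"
      by simp
  next
    assume "y \<in> Q \<inter> {y. u \<bullet> y = u \<bullet> x}"
    with x show "y \<in> maximal_face Q u"
      by (simp add: maximal_face_def)
  qed
qed

lemma maximal_face_face_of:
  assumes "convex Q"
  shows "maximal_face Q u face_of Q"
proof (cases "maximal_face Q u = {}")
  case False
  then obtain x where x: "x \<in> maximal_face Q u"
    by blast
  then have "maximal_face Q u = Q \<inter> {y. u \<bullet> y = u \<bullet> x}"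
    by (rule maximal_face_eq_supporting)
  moreover have "(Q \<inter> {y. u \<bullet> y = u \<bullet> x}) face_of Q"
    using x by (intro face_of_Int_supporting_hyperplane_le assms) (auto simp: maximal_face_def)
  ultimately show ?thesis
    by simp
qed simp

lemma polytope_face_imp_maximal_face:
  assumes "polytope Q" "F face_of Q" "F \<noteq> {}"
  obtains u where "F = maximal_face Q u"
proof -
  have "F exposed_face_of Q"
    using assms by (simp add: exposed_face_of_polyhedron polytope_imp_polyhedron)
  then obtain a b where ab: "Q \<subseteq> {x. a \<bullet> x \<le> b}" "F = Q \<inter> {x. a \<bullet> x = b}"
    by (auto simp: exposed_face_of_def)
  with \<open>F \<noteq> {}\<close> obtain x where "x \<in> Q" "a \<bullet> x = b"
    by blast
  moreover from this ab have "x \<in> maximal_face Q a"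
    by (auto simp: maximal_face_def)
  ultimately have "F = maximal_face Q a"
    using ab(2) maximal_face_eq_supporting by metis
  then show thesis
    by (rule that)
qed

lemma face_of_convex_hull_finite:
  fixes V :: "'a::euclidean_space set"
  assumes "finite V" "F face_of (convex hull V)"
  shows "F = convex hull (F \<inter> V)"
proof -
  obtain W where W: "W \<subseteq> V" "F = convex hull W"
    using face_of_convex_hull_subset [OF finite_imp_compact [OF assms(1)] assms(2)] by metis
  then have "W \<subseteq> F \<inter> V"
    using hull_subset [of W convex] by simp
  then have "F \<subseteq> convex hull (F \<inter> V)"
    unfolding W(2) by (rule hull_mono)
  moreover have "convex hull (F \<inter> V) \<subseteq> F"
    using face_of_imp_convex [OF assms(2)] by (intro hull_minimal) auto
  ultimately show ?thesis
    by blast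
qed

lemma maximal_face_convex_hull_mem:
  fixes V :: "'a::euclidean_space set"
  assumes "v \<in> V"
  shows "v \<in> maximal_face (convex hull V) u \<longleftrightarrow> (\<forall>w\<in>V. u \<bullet> w \<le> u \<bullet> v)"
proof
  assume R: "\<forall>w\<in>V. u \<bullet> w \<le> u \<bullet> v"
  have "convex hull V \<subseteq> {y. u \<bullet> y \<le> u \<bullet> v}"
    using R by (intro hull_minimal convex_halfspace_le) auto
  with assms show "v \<in> maximal_face (convex hull V) u"
    by (auto simp: maximal_face_def hull_inc)
qed (auto simp: maximal_face_def hull_inc)

text \<open>
  The relatively open normal cone of a face. Fixing one generator \<open>v\<close> in the face suffices: that \<open>v\<close>
  is maximal for \<open>w\<close>, and which other generators share the maximum, can be read off from the signs of
  \<open>w\<close> on the vectors \<open>x - v\<close>.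
\<close>
lemma normal_cone_is_sign_cell:
  fixes V :: "'a::euclidean_space set"
  assumes "finite V" "v \<in> V" "v \<in> maximal_face (convex hull V) u"
  shows "{w. maximal_face (convex hull V) w = maximal_face (convex hull V) u} =
         sign_cell ((\<lambda>x. x - v) ` V) u"
proof (intro set_eqI iffI; unfold mem_Collect_eq)
  fix w
  let ?F = "maximal_face (convex hull V)"
  have sign: "sgn ((x - v) \<bullet> z) = (if x \<in> ?F z then 0 else -1)"
    if xV: "x \<in> V" and vz: "v \<in> ?F z" for x z
  proof (cases "x \<in> ?F z")
    case True
    then have "z \<bullet> x = z \<bullet> v"
      using maximal_face_eq_supporting [OF vz] by blast
    with True show ?thesis
      by (simp add: inner_commute inner_diff_right)
  next
    case False
    then obtain y where "y \<in> V" "z \<bullet> x < z \<bullet> y"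
      using maximal_face_convex_hull_mem [OF xV] by (meson not_le)
    moreover have "z \<bullet> y \<le> z \<bullet> v"
      using vz \<open>y \<in> V\<close> by (auto simp: maximal_face_def hull_inc)
    ultimately show ?thesis
      using False by (simp add: inner_commute inner_diff_right)
  qed
  {
    assume "?F w = ?F u"
    then show "w \<in> sign_cell ((\<lambda>x. x - v) ` V) u"
      using sign assms(3) by (auto simp: sign_cell_def)
  next
    assume w: "w \<in> sign_cell ((\<lambda>x. x - v) ` V) u"
    have same: "sgn ((x - v) \<bullet> w) = (if x \<in> ?F u then 0 else -1)" if "x \<in> V" for x
      using w sign [of x u] that assms(3) by (simp add: sign_cell_def)
    have "(x - v) \<bullet> w \<le> 0" if "x \<in> V" for x
      using same [OF that] by (cases "x \<in> ?F u") (simp_all add: sgn_zero_iff sgn_1_neg)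
    then have v: "v \<in> ?F w"
      using assms(2) by (auto simp: maximal_face_convex_hull_mem inner_commute inner_diff_right)
    have "?F w \<inter> V = ?F u \<inter> V"
    proof -
      have "x \<in> ?F w \<longleftrightarrow> x \<in> ?F u" if "x \<in> V" for x
        using same [OF that] sign [OF that v] by (auto split: if_splits)
      then show ?thesis
        by blast
    qed
    then show "?F w = ?F u"
      using face_of_convex_hull_finite [OF assms(1)]
      by (metis convex_convex_hull maximal_face_face_of)
  }
qed

lemma codim_normal_cone:
  fixes V :: "'a::euclidean_space set"
  assumes "finite V" "v \<in> V" "v \<in> maximal_face (convex hull V) u"
  shows "int (dim {a \<in> (\<lambda>x. x - v) ` V. a \<bullet> u = 0}) = aff_dim (maximal_face (convex hull V) u)"
proof -
  let ?F = "maximal_face (convex hull V) u"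
  have "(x - v) \<bullet> u = 0 \<longleftrightarrow> x \<in> ?F" if "x \<in> V" for x
  proof
    assume "(x - v) \<bullet> u = 0"
    then have "u \<bullet> x = u \<bullet> v"
      by (simp add: inner_commute inner_diff_right)
    then show "x \<in> ?F"
      using maximal_face_eq_supporting [OF assms(3)] that by (simp add: hull_inc)
  next
    assume "x \<in> ?F"
    then have "u \<bullet> x = u \<bullet> v"
      using maximal_face_eq_supporting [OF assms(3)] by blast
    then show "(x - v) \<bullet> u = 0"
      by (simp add: inner_commute inner_diff_right)
  qed
  then have "{a \<in> (\<lambda>x. x - v) ` V. a \<bullet> u = 0} = (\<lambda>x. x - v) ` (?F \<inter> V)"
    by auto
  then have "int (dim {a \<in> (\<lambda>x. x - v) ` V. a \<bullet> u = 0}) = aff_dim (?F \<inter> V)"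
    using assms by (simp add: aff_dim_eq_dim_subtract [of v] hull_inc)
  also have "\<dots> = aff_dim ?F"
    using face_of_convex_hull_finite [OF assms(1) maximal_face_face_of [OF convex_convex_hull]]
    by (metis aff_dim_convex_hull)
  finally show ?thesis .
qed

text \<open>
  For finite \<open>V\<close>, an arrangement that refines those of the normal cones of all faces of
  \<open>convex hull V\<close>.
\<close>
definition differences :: "'a::euclidean_space set \<Rightarrow> 'a set" where
  "differences V = (\<lambda>(x, v). x - v) ` (V \<times> V)"

definition alternating_face_sum :: "('a::euclidean_space set \<Rightarrow> int) \<Rightarrow> 'a set \<Rightarrow> int" where
  "alternating_face_sum g Q =
     (\<Sum>F | F face_of Q \<and> F \<noteq> {}. (-1) ^ nat (aff_dim F) * g F)"

text \<open>
  The function \<open>u \<mapsto> g(Q\<^sup>u)\<close> is the combination, with coefficients \<open>g F\<close>, of the indicators of the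
  normal cones of the faces \<open>F\<close>. The integral of such an indicator may be computed in the coarse
  arrangement of which the cone is a single cell, where it is \<open>(-1)\<close> to the power
  \<open>dim F\<close>. For \<open>g = 1\<close> the integral is \<open>1\<close>, as in the empty
  arrangement, and this is Euler's relation.
\<close>
lemma alternating_face_sum_eq_euler_integral:
  assumes V: "finite V" "V \<noteq> {}" and B: "finite B" "differences V \<subseteq> B"
  shows "alternating_face_sum g (convex hull V) =
         euler_integral B (\<lambda>u. g (maximal_face (convex hull V) u))"
proof -
  let ?Q = "convex hull V"
  let ?faces = "{F. F face_of ?Q \<and> F \<noteq> {}}"
  have fin: "finite ?faces"
    using finite_polytope_faces [OF polytope_convex_hull [OF V(1)]]
    by (rule rev_finite_subset) auto
  have Q: "compact ?Q" "convex ?Q" "?Q \<noteq> {}" "polytope ?Q"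
    using V by (auto simp: finite_imp_compact_convex_hull polytope_convex_hull)
  have face: "maximal_face ?Q u \<in> ?faces" for u
    using Q by (simp add: maximal_face_face_of maximal_face_nonempty)
  have indicator: "euler_integral B (\<lambda>u. of_bool (maximal_face ?Q u = F)) = (-1) ^ nat (aff_dim F)"
    if F: "F face_of ?Q" "F \<noteq> {}" for F
  proof -
    obtain u where u: "F = maximal_face ?Q u"
      using polytope_face_imp_maximal_face [OF Q(4) F] by blast
    have "F \<inter> V \<noteq> {}"
      using face_of_convex_hull_finite [OF V(1) F(1)] F(2) by force
    then obtain v where v: "v \<in> V" "v \<in> maximal_face ?Q u"
      using u by blast
    let ?A = "(\<lambda>x. x - v) ` V"
    have cone: "maximal_face ?Q w = F \<longleftrightarrow> w \<in> sign_cell ?A u" for w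
      using normal_cone_is_sign_cell [OF V(1) v] u by blast
    have "?A \<subseteq> B"
      using B(2) v(1) by (auto simp: differences_def)
    moreover have "constant_on_cells ?A (\<lambda>w. of_bool (maximal_face ?Q w = F) :: int)"
      unfolding cone by (rule constant_on_cells_indicator)
    ultimately have "euler_integral B (\<lambda>w. of_bool (maximal_face ?Q w = F)) =
        euler_integral ?A (\<lambda>w. of_bool (maximal_face ?Q w = F))"
      by (rule euler_integral_refine [OF B(1)])
    also have "\<dots> = (-1) ^ dim {a \<in> ?A. a \<bullet> u = 0}"
      unfolding cone using V(1) by (intro euler_integral_cell_indicator) simp
    also have "dim {a \<in> ?A. a \<bullet> u = 0} = nat (aff_dim F)"
      using codim_normal_cone [OF V(1) v] u by (metis nat_int)
    finally show ?thesis .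
  qed
  have "g (maximal_face ?Q u) = (\<Sum>F\<in>?faces. g F * of_bool (maximal_face ?Q u = F))" for u
    using fin face [of u] by (simp add: of_bool_def if_distrib sum.delta cong: if_cong)
  then have "euler_integral B (\<lambda>u. g (maximal_face ?Q u)) =
      (\<Sum>F\<in>?faces. g F * euler_integral B (\<lambda>u. of_bool (maximal_face ?Q u = F)))"
    by (simp add: euler_integral_sum euler_integral_cmult)
  also have "\<dots> = alternating_face_sum g ?Q"
    unfolding alternating_face_sum_def by (rule sum.cong) (simp_all add: indicator)
  finally show ?thesis ..
qed

section \<open>Minkowski sums\<close>

lemma maximal_face_set_plus:
  "maximal_face (A + B) u = maximal_face A u + maximal_face B u"
proof (intro equalityI subsetI)
  fix x assume x: "x \<in> maximal_face (A + B) u"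
  then obtain a b where ab: "x = a + b" "a \<in> A" "b \<in> B"
    by (auto simp: maximal_face_def elim: set_plus_elim)
  have "u \<bullet> (y + z) \<le> u \<bullet> (a + b)" if "y \<in> A" "z \<in> B" for y z
    using x ab(1) that by (auto simp: maximal_face_def)
  from this [OF _ ab(3)] this [OF ab(2)] ab
  show "x \<in> maximal_face A u + maximal_face B u"
    by (intro set_plus_intro [of a _ b, folded ab(1)])
       (auto simp: maximal_face_def inner_add_right)
next
  fix x assume "x \<in> maximal_face A u + maximal_face B u"
  then show "x \<in> maximal_face (A + B) u"
    by (fastforce simp: maximal_face_def inner_add_right elim!: set_plus_elim intro: add_mono)
qed

lemma maximal_face_set_sum:
  assumes "finite I"
  shows "maximal_face (sum P I) u = (\<Sum>i\<in>I. maximal_face (P i) u)"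
  using assms
proof (induction I)
  case empty
  show ?case
    by (auto simp: maximal_face_def)
qed (simp add: maximal_face_set_plus)

lemma set_sum_nonempty:
  assumes "finite I" "\<And>i. i \<in> I \<Longrightarrow> G i \<noteq> {}"
  shows "sum G I \<noteq> {}"
proof -
  have "sum (\<lambda>i. SOME x. x \<in> G i) I \<in> sum G I"
    unfolding set_sum_alt [OF assms(1)] using assms(2) by (auto simp: some_in_eq)
  then show ?thesis
    by blast
qed

text \<open>
  Choosing base points turns a Minkowski sum of sets into a sum of linear subspaces, for which the
  dimension formula is available.
\<close>
lemma aff_dim_set_plus:
  fixes A B :: "'a::euclidean_space set"
  assumes "a \<in> A" "b \<in> B"
  shows "aff_dim (A + B) =
    int (dim {x + y | x y. x \<in> span ((\<lambda>x. x - a) ` A) \<and> y \<in> span ((\<lambda>y. y - b) ` B)})"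
proof -
  let ?A = "(\<lambda>x. x - a) ` A" and ?B = "(\<lambda>y. y - b) ` B"
  have zero: "0 \<in> ?A" "0 \<in> ?B"
    using assms by auto
  have "(\<lambda>z. z - (a + b)) ` (A + B) = ?A + ?B"
  proof (intro equalityI subsetI)
    fix z assume "z \<in> (\<lambda>z. z - (a + b)) ` (A + B)"
    then obtain x y where "x \<in> A" "y \<in> B" "z = (x - a) + (y - b)"
      by (auto elim!: set_plus_elim simp: algebra_simps)
    then show "z \<in> ?A + ?B"
      by blast
  next
    fix z assume "z \<in> ?A + ?B"
    then obtain x y where "x \<in> A" "y \<in> B" "z = (x + y) - (a + b)"
      by (auto elim!: set_plus_elim simp: algebra_simps)
    then show "z \<in> (\<lambda>z. z - (a + b)) ` (A + B)"
      by blast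
  qed
  moreover have "a + b \<in> A + B"
    using assms by blast
  ultimately have "aff_dim (A + B) = int (dim (?A + ?B))"
    by (simp add: aff_dim_eq_dim_subtract [of "a + b"] hull_inc)
  also have "dim (?A + ?B) = dim (?A \<union> ?B)"
  proof (rule antisym)
    have "?A + ?B \<subseteq> span (?A \<union> ?B)"
      by (auto elim!: set_plus_elim intro!: span_add intro: span_base)
    then show "dim (?A + ?B) \<le> dim (?A \<union> ?B)"
      by (metis dim_span dim_subset)
    have "?A \<union> ?B \<subseteq> ?A + ?B"
      using set_plus_intro [OF _ zero(2), of _ ?A] set_plus_intro [OF zero(1), of _ ?B] by auto
    then show "dim (?A \<union> ?B) \<le> dim (?A + ?B)"
      by (rule dim_subset)
  qed
  also have "\<dots> = dim (span (?A \<union> ?B))"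
    by simp
  finally show ?thesis
    by (simp only: span_Un)
qed

text \<open>
  Replacing a summand by a subset lowers the dimension of the sum by at most the drop in the
  dimension of the summand. In terms of linear spans \<open>M \<subseteq> L\<close> and \<open>N\<close>, this says that
  \<open>dim (M \<inter> N) \<le> dim (L \<inter> N)\<close>.
\<close>
lemma aff_dim_set_plus_exchange:
  fixes G H K :: "'a::euclidean_space set"
  assumes "H \<subseteq> G" "H \<noteq> {}" "K \<noteq> {}"
  shows "aff_dim (G + K) + aff_dim H \<le> aff_dim (H + K) + aff_dim G"
proof -
  obtain h k where hk: "h \<in> H" "k \<in> K"
    using assms by blast
  define L where "L = span ((\<lambda>x. x - h) ` G)"
  define M where "M = span ((\<lambda>x. x - h) ` H)"
  define N where "N = span ((\<lambda>x. x - k) ` K)"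
  have "subspace L" "subspace M" "subspace N"
    by (auto simp: L_def M_def N_def)
  then have "dim {x + y |x y. x \<in> L \<and> y \<in> N} + dim (L \<inter> N) = dim L + dim N"
    and "dim {x + y |x y. x \<in> M \<and> y \<in> N} + dim (M \<inter> N) = dim M + dim N"
    by (auto intro: dim_sums_Int)
  moreover have "dim (M \<inter> N) \<le> dim (L \<inter> N)"
  proof (rule dim_subset)
    have "M \<subseteq> L"
      unfolding L_def M_def using assms(1) by (intro span_mono image_mono)
    then show "M \<inter> N \<subseteq> L \<inter> N"
      by blast
  qed
  moreover have "aff_dim G = int (dim L)" "aff_dim H = int (dim M)"
    using hk assms by (auto simp: L_def M_def aff_dim_eq_dim_subtract [of h] hull_inc)
  moreover have "aff_dim (G + K) = int (dim {x + y |x y. x \<in> L \<and> y \<in> N})"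
    "aff_dim (H + K) = int (dim {x + y |x y. x \<in> M \<and> y \<in> N})"
    unfolding L_def M_def N_def using hk assms(1) by (auto intro!: aff_dim_set_plus)
  ultimately show ?thesis
    by linarith
qed

lemma aff_dim_set_plus_le:
  fixes A B :: "'a::euclidean_space set"
  assumes "A \<noteq> {}" "B \<noteq> {}"
  shows "aff_dim (A + B) \<le> aff_dim A + aff_dim B"
proof -
  obtain a where "a \<in> A"
    using assms by blast
  then have "aff_dim (A + B) + aff_dim {a} \<le> aff_dim ({a} + B) + aff_dim A"
    using assms by (intro aff_dim_set_plus_exchange) auto
  moreover have "{a} + B = (+) a ` B"
    by (auto simp: set_plus_def)
  ultimately show ?thesis
    by (simp add: aff_dim_translation_eq)
qed

lemma aff_dim_set_sum_le:
  fixes G :: "'i \<Rightarrow> 'a::euclidean_space set"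
  assumes "finite I" "\<And>i. i \<in> I \<Longrightarrow> G i \<noteq> {}"
  shows "aff_dim (sum G I) \<le> (\<Sum>i\<in>I. aff_dim (G i))"
  using assms
proof (induction I)
  case (insert i I)
  then have "aff_dim (G i + sum G I) \<le> aff_dim (G i) + aff_dim (sum G I)"
    by (intro aff_dim_set_plus_le set_sum_nonempty) auto
  with insert show ?case
    by force
qed simp

lemma aff_dim_set_sum_exchange:
  fixes G H :: "'i \<Rightarrow> 'a::euclidean_space set"
  assumes "finite I" "\<And>i. i \<in> I \<Longrightarrow> H i \<subseteq> G i \<and> H i \<noteq> {}"
  shows "aff_dim (sum G I) + (\<Sum>i\<in>I. aff_dim (H i)) \<le> aff_dim (sum H I) + (\<Sum>i\<in>I. aff_dim (G i))"
  using assms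
proof (induction I)
  case (insert i I)
  have ne: "sum G I \<noteq> {}" "sum H I \<noteq> {}" "sum H I \<subseteq> sum G I"
  proof -
    show "sum G I \<noteq> {}"
      using insert.prems by (intro set_sum_nonempty insert.hyps(1)) blast
    show "sum H I \<noteq> {}"
      using insert.prems by (intro set_sum_nonempty insert.hyps(1)) blast
    show "sum H I \<subseteq> sum G I"
      using insert.prems by (fastforce simp: set_sum_alt [OF insert.hyps(1)])
  qed
  have Hi: "H i \<subseteq> G i" "H i \<noteq> {}"
    using insert.prems by auto
  have "aff_dim (G i + sum G I) + aff_dim (H i) \<le> aff_dim (H i + sum G I) + aff_dim (G i)"
    using Hi ne by (intro aff_dim_set_plus_exchange)
  moreover have "aff_dim (sum G I + H i) + aff_dim (sum H I) \<le> aff_dim (sum H I + H i) + aff_dim (sum G I)"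
    using Hi ne by (intro aff_dim_set_plus_exchange)
  moreover have "aff_dim (sum G I) + (\<Sum>i\<in>I. aff_dim (H i)) \<le> aff_dim (sum H I) + (\<Sum>i\<in>I. aff_dim (G i))"
    using insert by blast
  ultimately show ?case
    using insert.hyps by (simp add: add.commute)
qed simp

text \<open>
  If the directions of the \<open>G i\<close> are linearly independent of each other, then so are those of any
  subsets. The exchange inequality expresses this without mentioning direct sums.
\<close>
lemma exact_subsets:
  fixes G H :: "'i \<Rightarrow> 'a::euclidean_space set"
  assumes "finite I" "exact I (sum G I) G" "\<And>i. i \<in> I \<Longrightarrow> H i \<subseteq> G i \<and> H i \<noteq> {}"
  shows "exact I (sum H I) H"
  using aff_dim_set_sum_exchange [OF assms(1,3)] aff_dim_set_sum_le [OF assms(1), of H] assms(2,3)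
  unfolding exact_def by fastforce

section \<open>Faces of a sum in relatively general position\<close>

text \<open>
  This replaces the uniqueness of decompositions. If some \<open>x\<close> in \<open>(P i)\<^sup>u\<close> were not in \<open>G i\<close>, a
  functional \<open>a\<close> would be strictly smaller at \<open>x\<close> than on \<open>G i\<close>. Combine \<open>x\<close> with minimisers of \<open>a\<close>
  on the other \<open>(P j)\<^sup>u\<close>. The resulting point of \<open>(sum P I)\<^sup>u\<close> is also a sum of points \<open>g j\<close> of the
  \<open>G j\<close>, and maximality of \<open>u\<close> forces these into the faces \<open>(P j)\<^sup>u\<close>. But then \<open>a\<close> is larger at the sum
  of the \<open>g j\<close> than at the point itself.
\<close>
lemma maximal_face_summand_subset:
  fixes P G :: "'i \<Rightarrow> 'a::euclidean_space set"
  assumes "finite I" and P: "\<And>i. i \<in> I \<Longrightarrow> polytope (P i) \<and> P i \<noteq> {}"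
    and G: "\<And>i. i \<in> I \<Longrightarrow> G i face_of P i"
    and sub: "maximal_face (sum P I) u \<subseteq> sum G I" and i: "i \<in> I"
  shows "maximal_face (P i) u \<subseteq> G i"
proof
  fix x assume x: "x \<in> maximal_face (P i) u"
  let ?M = "\<lambda>j. maximal_face (P j) u"
  show "x \<in> G i"
  proof (rule ccontr)
    assume "x \<notin> G i"
    moreover have "convex (G i)" "closed (G i)"
      using G [OF i] P [OF i]
      by (auto intro: face_of_imp_convex face_of_polytope_polytope polytope_imp_closed)
    ultimately obtain a b where ab: "a \<bullet> x < b" "\<And>g. g \<in> G i \<Longrightarrow> a \<bullet> g > b"
      using separating_hyperplane_closed_point [of "G i" x] by blast
    have "\<exists>y\<in>?M j. \<forall>z\<in>?M j. a \<bullet> y \<le> a \<bullet> z" if "j \<in> I" for j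
    proof -
      have "?M j face_of P j"
        using P [OF that] by (simp add: maximal_face_face_of polytope_imp_convex)
      then have "compact (?M j)" "?M j \<noteq> {}"
        using P [OF that] by (auto simp: maximal_face_nonempty polytope_imp_compact
            intro: face_of_polytope_polytope polytope_imp_compact)
      then show ?thesis
        by (intro continuous_attains_inf continuous_intros)
    qed
    then obtain y where y: "\<And>j. j \<in> I \<Longrightarrow> y j \<in> ?M j"
        "\<And>j z. \<lbrakk>j \<in> I; z \<in> ?M j\<rbrakk> \<Longrightarrow> a \<bullet> y j \<le> a \<bullet> z"
      by metis
    define s where "s = y(i := x)"
    have s: "s j \<in> ?M j" if "j \<in> I" for j
      using y(1) x that by (simp add: s_def)
    then have "sum s I \<in> (\<Sum>j\<in>I. ?M j)"
      unfolding set_sum_alt [OF \<open>finite I\<close>] by blast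
    then have "sum s I \<in> sum G I"
      using sub maximal_face_set_sum [OF \<open>finite I\<close>] by blast
    then obtain g where g: "\<And>j. j \<in> I \<Longrightarrow> g j \<in> G j" "sum s I = sum g I"
      unfolding set_sum_alt [OF \<open>finite I\<close>] by auto
    have gP: "g j \<in> P j" if "j \<in> I" for j
      using g(1) G that face_of_imp_subset by blast
    have le: "u \<bullet> g j \<le> u \<bullet> s j" if "j \<in> I" for j
      using gP s that by (simp add: maximal_face_def)
    have "(\<Sum>j\<in>I. u \<bullet> g j) = (\<Sum>j\<in>I. u \<bullet> s j)"
      using g(2) by (metis inner_sum_right)
    then have eq: "u \<bullet> g j = u \<bullet> s j" if "j \<in> I" for j
      using sum_mono_inv [of "\<lambda>j. u \<bullet> g j" I "\<lambda>j. u \<bullet> s j"] le that \<open>finite I\<close> by blast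
    have gM: "g j \<in> ?M j" if "j \<in> I" for j
      using maximal_face_eq_supporting [OF s [OF that]] gP eq that by blast
    have "(\<Sum>j\<in>I. a \<bullet> s j) < (\<Sum>j\<in>I. a \<bullet> g j)"
    proof (rule sum_strict_mono_ex1 [OF \<open>finite I\<close>])
      have "a \<bullet> s i < a \<bullet> g i"
        using ab(1) ab(2) [OF g(1) [OF i]] by (simp add: s_def)
      moreover have "a \<bullet> s j \<le> a \<bullet> g j" if "j \<in> I" "j \<noteq> i" for j
        using y(2) gM that by (simp add: s_def)
      ultimately show "\<forall>j\<in>I. a \<bullet> s j \<le> a \<bullet> g j" "\<exists>j\<in>I. a \<bullet> s j < a \<bullet> g j"
        using i by (force, blast)
    qed
    then show False
      using g(2) by (simp add: inner_sum_right [symmetric])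
  qed
qed

lemma polytope_set_sum:
  assumes "finite I" "\<And>i. i \<in> I \<Longrightarrow> polytope (P i)"
  shows "polytope (sum P I)"
proof -
  obtain V where V: "\<And>i. i \<in> I \<Longrightarrow> finite (V i) \<and> P i = convex hull (V i)"
    using assms(2) unfolding polytope_def by metis
  then have "sum P I = convex hull (sum V I)"
    by (simp add: convex_hull_set_sum)
  moreover have "finite (sum V I)"
    using \<open>finite I\<close> V by (induction I) (auto intro: finite_set_plus)
  ultimately show ?thesis
    unfolding polytope_def by blast
qed

text \<open>
  A proper face lies in a facet, the facet decomposes exactly, and the summands of the face lie in
  those of the facet.
\<close>
lemma proper_maximal_face_exact:
  fixes P :: "'i \<Rightarrow> 'a::euclidean_space set"
  assumes "finite I" and P: "\<And>i. i \<in> I \<Longrightarrow> polytope (P i) \<and> P i \<noteq> {}"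
    and "relatively_in_general_position I P"
    and proper: "maximal_face (sum P I) u \<noteq> sum P I"
  shows "aff_dim (maximal_face (sum P I) u) = (\<Sum>i\<in>I. aff_dim (maximal_face (P i) u))"
proof -
  have poly: "polytope (sum P I)" "sum P I \<noteq> {}"
    using P by (intro polytope_set_sum set_sum_nonempty \<open>finite I\<close>; blast)+
  then have "maximal_face (sum P I) u face_of sum P I" "maximal_face (sum P I) u \<noteq> {}"
    by (auto simp: maximal_face_face_of polytope_imp_convex maximal_face_nonempty polytope_imp_compact)
  then obtain F where F: "F facet_of sum P I" "maximal_face (sum P I) u \<subseteq> F"
    using face_of_polyhedron_subset_facet poly proper polytope_imp_polyhedron by metis
  then obtain G where "decomposition I P F G" "exact I F G"
    using assms(3) by (auto simp: relatively_in_general_position_def)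
  then have G: "F = sum G I" "\<And>i. i \<in> I \<Longrightarrow> G i face_of P i" "exact I (sum G I) G"
    by (auto simp: decomposition_def)
  have "exact I (\<Sum>i\<in>I. maximal_face (P i) u) (\<lambda>i. maximal_face (P i) u)"
  proof (rule exact_subsets [OF \<open>finite I\<close> G(3)])
    fix i assume i: "i \<in> I"
    show "maximal_face (P i) u \<subseteq> G i \<and> maximal_face (P i) u \<noteq> {}"
      using maximal_face_summand_subset [OF \<open>finite I\<close> P G(2) _ i] F(2) G(1) P [OF i]
      by (simp add: maximal_face_nonempty polytope_imp_compact)
  qed
  then show ?thesis
    by (simp add: exact_def maximal_face_set_sum [OF \<open>finite I\<close>])
qed

text \<open>
  The inclusion \<open>maximal_face_summand_subset\<close> applies to \<open>P = P\<^sup>0\<close>, which is contained in the sum of the faces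
  \<open>(P i)\<^sup>u\<close>.
\<close>
lemma improper_maximal_face_summand:
  fixes P :: "'i \<Rightarrow> 'a::euclidean_space set"
  assumes "finite I" and P: "\<And>i. i \<in> I \<Longrightarrow> polytope (P i) \<and> P i \<noteq> {}"
    and "maximal_face (sum P I) u = sum P I" "i \<in> I"
  shows "maximal_face (P i) u = P i"
proof
  have "maximal_face (P i) 0 \<subseteq> maximal_face (P i) u"
    using P assms(3) maximal_face_set_sum [OF \<open>finite I\<close>, of P u]
    by (intro maximal_face_summand_subset [OF \<open>finite I\<close> P _ _ \<open>i \<in> I\<close>])
       (auto simp: maximal_face_face_of polytope_imp_convex)
  then show "P i \<subseteq> maximal_face (P i) u"
    by simp
qed (rule maximal_face_subset)

lemma alternating_face_sum_indicator:
  assumes "polytope Q" "Q \<noteq> {}"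
  shows "alternating_face_sum (\<lambda>F. of_bool (F = Q)) Q = (-1) ^ nat (aff_dim Q)"
proof -
  have "finite {F. F face_of Q \<and> F \<noteq> {}}"
    using finite_polytope_faces [OF assms(1)] by (rule rev_finite_subset) auto
  then show ?thesis
    using assms
    by (simp add: alternating_face_sum_def of_bool_def if_distrib sum.delta polytope_imp_convex
        face_of_refl cong: if_cong)
qed

text \<open>
  The face-theoretic core: \<open>aff_dim\<close> is integrated over the dual space for \<open>P\<close> and for all summands,
  using one arrangement \<open>B\<close> that is fine enough for every one of these polytopes.
\<close>
lemma alternating_dimension_sum:
  fixes P :: "'i \<Rightarrow> 'a::euclidean_space set"
  assumes "finite I" and P: "\<And>i. i \<in> I \<Longrightarrow> polytope (P i) \<and> P i \<noteq> {}"
    and "relatively_in_general_position I P"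
  shows "alternating_face_sum aff_dim (sum P I) - (\<Sum>i\<in>I. alternating_face_sum aff_dim (P i)) =
         (-1) ^ nat (aff_dim (sum P I)) * (aff_dim (sum P I) - (\<Sum>i\<in>I. aff_dim (P i)))"
proof -
  let ?P = "sum P I"
  let ?c = "aff_dim ?P - (\<Sum>i\<in>I. aff_dim (P i))"
  have poly: "polytope ?P" "?P \<noteq> {}"
    using P by (intro polytope_set_sum set_sum_nonempty \<open>finite I\<close>; blast)+
  then obtain W where W: "finite W" "?P = convex hull W" "W \<noteq> {}"
    unfolding polytope_def by (metis convex_hull_eq_empty)
  have "\<exists>V. finite V \<and> P i = convex hull V \<and> V \<noteq> {}" if "i \<in> I" for i
    using P [OF that] unfolding polytope_def by (metis convex_hull_eq_empty)
  then obtain V where V: "\<And>i. i \<in> I \<Longrightarrow> finite (V i) \<and> P i = convex hull (V i) \<and> V i \<noteq> {}"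
    by metis
  define B where "B = differences W \<union> (\<Union>i\<in>I. differences (V i))"
  have B: "finite B" "differences W \<subseteq> B" "\<And>i. i \<in> I \<Longrightarrow> differences (V i) \<subseteq> B"
    using W V \<open>finite I\<close> by (auto simp: B_def differences_def)
  have integrand: "aff_dim (maximal_face ?P u) - (\<Sum>i\<in>I. aff_dim (maximal_face (P i) u)) =
      ?c * of_bool (maximal_face ?P u = ?P)" for u
  proof (cases "maximal_face ?P u = ?P")
    case True
    have "maximal_face (P i) u = P i" if "i \<in> I" for i
      using improper_maximal_face_summand [OF assms(1) P True that] .
    with True show ?thesis
      by simp
  next
    case False
    then show ?thesis
      using proper_maximal_face_exact [OF assms(1) P assms(3)] by simp
  qed
  have sumP: "alternating_face_sum g ?P = euler_integral B (\<lambda>u. g (maximal_face ?P u))" for g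
    unfolding W(2) by (rule alternating_face_sum_eq_euler_integral [OF W(1,3) B(1,2)])
  have summand: "alternating_face_sum aff_dim (P i) = euler_integral B (\<lambda>u. aff_dim (maximal_face (P i) u))"
    if "i \<in> I" for i
    using V [OF that] alternating_face_sum_eq_euler_integral [OF _ _ B(1) B(3) [OF that]] by metis
  have "alternating_face_sum aff_dim ?P - (\<Sum>i\<in>I. alternating_face_sum aff_dim (P i)) =
      euler_integral B (\<lambda>u. aff_dim (maximal_face ?P u) - (\<Sum>i\<in>I. aff_dim (maximal_face (P i) u)))"
    by (simp add: sumP summand euler_integral_diff euler_integral_sum)
  also have "\<dots> = ?c * alternating_face_sum (\<lambda>F. of_bool (F = ?P)) ?P"
    unfolding integrand sumP by (rule euler_integral_cmult)
  also have "\<dots> = (-1) ^ nat (aff_dim ?P) * ?c"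
    using poly by (simp add: alternating_face_sum_indicator)
  finally show ?thesis .
qed

section \<open>Counting faces by dimension\<close>

lemma num_faces_top:
  assumes "polytope Q" "aff_dim Q \<le> int d"
  shows "num_faces d Q = of_bool (aff_dim Q = int d)"
proof -
  have "{F. F face_of Q \<and> aff_dim F = int d} = (if aff_dim Q = int d then {Q} else {})"
    using face_of_aff_dim_lt [of Q] assms polytope_imp_convex [OF assms(1)]
    by (auto simp: face_of_refl) (metis order.strict_iff_not)+
  then show ?thesis
    by (simp add: num_faces_def)
qed

lemma alternating_num_faces_sum:
  assumes "polytope Q" "aff_dim Q \<le> int d"
  shows "(\<Sum>k<d. (-1) ^ k * int k * int (num_faces k Q)) =
         alternating_face_sum aff_dim Q - (-1) ^ d * int d * of_bool (aff_dim Q = int d)"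
proof -
  let ?faces = "{F. F face_of Q \<and> F \<noteq> {}}"
  have fin: "finite ?faces"
    using finite_polytope_faces [OF assms(1)] by (rule rev_finite_subset) auto
  have dim: "0 \<le> aff_dim F \<and> aff_dim F \<le> int d" if "F \<in> ?faces" for F
  proof
    show "0 \<le> aff_dim F"
      using that by (intro leI) simp
    show "aff_dim F \<le> int d"
      using that assms(2) aff_dim_subset [OF face_of_imp_subset, of F Q] by simp
  qed
  have "alternating_face_sum aff_dim Q =
      (\<Sum>k\<le>d. \<Sum>F\<in>{F \<in> ?faces. nat (aff_dim F) = k}. (-1) ^ nat (aff_dim F) * aff_dim F)"
    unfolding alternating_face_sum_def
  proof (rule sum.group [symmetric, OF fin])
    have "nat (aff_dim F) \<le> d" if "F \<in> ?faces" for F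
      using dim [OF that] by linarith
    then show "(\<lambda>F. nat (aff_dim F)) ` ?faces \<subseteq> {..d}"
      by blast
  qed simp
  also have "\<dots> = (\<Sum>k\<le>d. (-1) ^ k * int k * int (num_faces k Q))"
  proof (rule sum.cong)
    fix k
    have "{F \<in> ?faces. nat (aff_dim F) = k} = {F. F face_of Q \<and> aff_dim F = int k}"
    proof (intro Collect_cong iffI)
      fix F assume "F \<in> ?faces \<and> nat (aff_dim F) = k"
      then show "F face_of Q \<and> aff_dim F = int k"
        using dim [of F] by auto
    qed auto
    then show "(\<Sum>F\<in>{F \<in> ?faces. nat (aff_dim F) = k}. (-1) ^ nat (aff_dim F) * aff_dim F) =
        (-1) ^ k * int k * int (num_faces k Q)"
      by (simp add: num_faces_def)
  qed simp
  also have "\<dots> = (\<Sum>k<d. (-1) ^ k * int k * int (num_faces k Q)) +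
      (-1) ^ d * int d * of_bool (aff_dim Q = int d)"
    by (simp add: lessThan_Suc_atMost [symmetric] num_faces_top [OF assms])
  finally show ?thesis
    by simp
qed

lemma aff_dim_summand_le:
  fixes P :: "'i \<Rightarrow> 'a::euclidean_space set"
  assumes "finite I" "\<And>i. i \<in> I \<Longrightarrow> P i \<noteq> {}" "i \<in> I"
  shows "aff_dim (P i) \<le> aff_dim (sum P I)"
proof -
  have "sum P (I - {i}) \<noteq> {}"
    using assms by (intro set_sum_nonempty) auto
  then obtain c where c: "c \<in> sum P (I - {i})"
    by blast
  have "sum P I = sum P (I - {i}) + P i"
    using assms by (simp add: sum.remove add.commute)
  then have "(+) c ` P i \<subseteq> sum P I"
    using c by auto
  then show ?thesis
    using aff_dim_subset aff_dim_translation_eq by metis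
qed

theorem theorem4:
  fixes P :: "nat \<Rightarrow> 'a::euclidean_space set" and r d :: nat
  assumes "r \<ge> 1"
    and "\<And>i. i \<in> {1..r} \<Longrightarrow> polytope (P i) \<and> P i \<noteq> {}"
    and "relatively_in_general_position {1..r} P"
    and "aff_dim (sum P {1..r}) = int d"
  shows "(\<Sum>k\<in>{0..<d}. (-1) ^ k * int k * f_delta k {1..r} P) =
         (-1) ^ (d + 1) * (\<Sum>i\<in>{i \<in> {1..r}. aff_dim (P i) < int d}. aff_dim (P i))"
proof -
  let ?I = "{1..r}"
  let ?A = "alternating_face_sum aff_dim"
  define top where "top i = (of_bool (aff_dim (P i) = int d) :: int)" for i
  have poly: "polytope (sum P ?I)"
    using assms(2) by (intro polytope_set_sum) auto
  have le: "aff_dim (P i) \<le> int d" if "i \<in> ?I" for i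
    using aff_dim_summand_le [of ?I P i] assms(2,4) that by auto
  have "(\<Sum>k\<in>{0..<d}. (-1) ^ k * int k * f_delta k ?I P) =
      (\<Sum>k<d. (-1) ^ k * int k * int (num_faces k (sum P ?I))) -
      (\<Sum>i\<in>?I. \<Sum>k<d. (-1) ^ k * int k * int (num_faces k (P i)))"
    by (simp add: f_delta_def right_diff_distrib sum_subtractf sum_distrib_left atLeast0LessThan)
       (rule sum.swap)
  also have "\<dots> = (?A (sum P ?I) - (-1) ^ d * int d) -
      (\<Sum>i\<in>?I. ?A (P i) - (-1) ^ d * int d * top i)"
    using assms(2,4) le poly by (simp add: alternating_num_faces_sum top_def)
  also have "\<dots> = (?A (sum P ?I) - (\<Sum>i\<in>?I. ?A (P i))) - (-1) ^ d * int d +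
      (\<Sum>i\<in>?I. (-1) ^ d * int d * top i)"
    by (simp add: sum_subtractf)
  also have "?A (sum P ?I) - (\<Sum>i\<in>?I. ?A (P i)) = (-1) ^ d * (int d - (\<Sum>i\<in>?I. aff_dim (P i)))"
    using alternating_dimension_sum [OF _ assms(2,3)] assms(4) by simp
  also have "(-1) ^ d * (int d - (\<Sum>i\<in>?I. aff_dim (P i))) - (-1) ^ d * int d +
      (\<Sum>i\<in>?I. (-1) ^ d * int d * top i) = (-1) ^ (d + 1) * (\<Sum>i\<in>?I. aff_dim (P i) - int d * top i)"
    by (simp only: sum_subtractf sum_distrib_left [symmetric]) (simp add: algebra_simps)
  also have "(\<Sum>i\<in>?I. aff_dim (P i) - int d * top i) = (\<Sum>i\<in>{i \<in> ?I. aff_dim (P i) < int d}. aff_dim (P i))"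
    unfolding sum.inter_filter [OF finite_atLeastAtMost]
    by (rule sum.cong) (use le in \<open>auto simp: top_def order.order_iff_strict\<close>)
  finally show ?thesis .
qed

end
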